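(* Let $X$ be a non-trivial connected, twin-free graph such that every edge of $X$ lies on a triangle. If for all pairs $x,y\in V(X)$ of adjacent vertices and all pairs $z,w\in V(X)$ of vertices at distance $2$ from each other, it holds that $$|N_X(x)\cap N_X(y)| \neq |N_X(z)\cap N_X(w)|,$$ then $X$ is stable.
   Context: All graphs are finite, simple and undirected. A graph is non-trivial if it has more than one vertex. $N_X(x)$ denotes the set of neighbours of $x$ in $X$. A graph is twin-free if distinct vertices have different neighbourhoods. The canonical double cover $BX$ of a graph $X$ is the direct product $X\times K_2$: $V(BX)=V(X)\times\{0,1\}$ and $E(BX)=\{\{(x,0),(y,1)\}\mid \{x,y\}\in E(X)\}$. Each $\varphi\in\operatorname{Aut}(X)$ lifts to the automorphism $(x,i)\mapsto(\varphi(x),i)$ of $BX$, and $\tau:(x,i)\mapsto(x,i+1)$ (second coordinate mod $2$) is also an automorphism of $BX$; the lifts and $\tau$ generate a subgroup of $\operatorname{Aut}(BX)$ isomorphic to $\operatorname{Aut}(X)\times S_2$. The graph $X$ is stable if $\operatorname{Aut}(BX)\cong\operatorname{Aut}(X)\times S_2$, equivalently if every automorphism of $BX$ belongs to this subgroup; otherwise $X$ is unstable. *)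

theory Defs
  imports
    "HOL-Algebra.Sym_Groups"
    "Graph_Theory.Digraph_Component"
    "Graph_Theory.Shortest_Path"
begin

(* A finite simple undirected graph is a pair digraph satisfying the locale predicate
   pair_graph: finite, loop-free, with a symmetric arc set.  The edge {x, y} is the pair of
   arcs (x, y) and (y, x). *)

definition neighbours :: "'a pair_pre_digraph \<Rightarrow> 'a \<Rightarrow> 'a set" where
  "neighbours X x = {y. (x, y) \<in> parcs X}"

definition twin_free :: "'a pair_pre_digraph \<Rightarrow> bool" where
  "twin_free X \<longleftrightarrow>
    (\<forall>x\<in>pverts X. \<forall>y\<in>pverts X. x \<noteq> y \<longrightarrow> neighbours X x \<noteq> neighbours X y)"

definition edges_on_triangles :: "'a pair_pre_digraph \<Rightarrow> bool" where
  "edges_on_triangles X \<longleftrightarrow>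
    (\<forall>x y. (x, y) \<in> parcs X \<longrightarrow> (\<exists>z. (x, z) \<in> parcs X \<and> (y, z) \<in> parcs X))"

(* The library's weighted shortest-path distance, every arc having weight 1; it is infinite
   if there is no walk from u to v. *)
definition distance :: "'a pair_pre_digraph \<Rightarrow> 'a \<Rightarrow> 'a \<Rightarrow> ereal" where
  "distance X u v = wf_digraph.\<mu> (with_proj X) (\<lambda>_. 1) u v"

definition direct_product ::
    "'a pair_pre_digraph \<Rightarrow> 'b pair_pre_digraph \<Rightarrow> ('a \<times> 'b) pair_pre_digraph" where
  "direct_product X Y =
    \<lparr> pverts = pverts X \<times> pverts Y,
      parcs = {((x, u), (y, v)) | x u y v. (x, y) \<in> parcs X \<and> (u, v) \<in> parcs Y} \<rparr>"

definition K2 :: "nat pair_pre_digraph" where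
  "K2 = \<lparr> pverts = {0, 1}, parcs = {(0, 1), (1, 0)} \<rparr>"

definition canonical_double_cover :: "'a pair_pre_digraph \<Rightarrow> ('a \<times> nat) pair_pre_digraph" where
  "canonical_double_cover X = direct_product X K2"

(* Automorphisms are represented by functions that are the identity outside the vertex set
   (as in sym_group), so that distinct functions are distinct automorphisms. *)
definition Aut :: "'a pair_pre_digraph \<Rightarrow> ('a \<Rightarrow> 'a) monoid" where
  "Aut X =
    \<lparr> carrier = {p. p permutes pverts X \<and>
        (\<forall>x\<in>pverts X. \<forall>y\<in>pverts X. (p x, p y) \<in> parcs X \<longleftrightarrow> (x, y) \<in> parcs X)},
      mult = (\<circ>),
      one = id \<rparr>"

definition stable_graph :: "'a pair_pre_digraph \<Rightarrow> bool" where
  "stable_graph X \<longleftrightarrow> Aut (canonical_double_cover X) \<cong> Aut X \<times>\<times> sym_group 2"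

lemma pair_graph_canonical_double_cover:
  assumes "pair_graph X"
  shows "pair_graph (canonical_double_cover X)"
proof -
  interpret X: pair_graph X by fact
  let ?B = "canonical_double_cover X"
  have v: "pverts ?B = pverts X \<times> {0, 1}"
    by (simp add: canonical_double_cover_def direct_product_def K2_def)
  have a: "((x, i), (y, j)) \<in> parcs ?B \<longleftrightarrow>
      (x, y) \<in> parcs X \<and> (i = 0 \<and> j = 1 \<or> i = 1 \<and> j = 0)" for x i y j
    by (auto simp: canonical_double_cover_def direct_product_def K2_def)
  have sub: "parcs ?B \<subseteq> pverts ?B \<times> pverts ?B"
    by (auto simp: v a dest: X.in_arcsD1 X.in_arcsD2)
  have fin: "finite (pverts ?B)"
    by (simp add: v)
  show ?thesis
  proof
    show "finite (parcs ?B)"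
      using finite_subset[OF sub] fin by simp
    show "symmetric (with_proj ?B)"
      using X.arcs_symmetric by (auto simp: symmetric_def sym_def arcs_ends_conv a)
  qed (use sub fin in \<open>auto simp: a\<close>)
qed

lemma group_Aut: "group (Aut X)"
proof (rule groupI)
  fix p assume p: "p \<in> carrier (Aut X)"
  then have perm: "p permutes pverts X"
    and arcs: "\<And>x y. x \<in> pverts X \<Longrightarrow> y \<in> pverts X \<Longrightarrow>
      (p x, p y) \<in> parcs X \<longleftrightarrow> (x, y) \<in> parcs X"
    by (auto simp: Aut_def)
  let ?q = "inv_into UNIV p"
  have inv: "?q permutes pverts X"
    using perm by (rule permutes_inv)
  have "(?q x, ?q y) \<in> parcs X \<longleftrightarrow> (x, y) \<in> parcs X"
    if "x \<in> pverts X" "y \<in> pverts X" for x y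
    using arcs[of "?q x" "?q y"] that
    by (simp add: permutes_in_image[OF inv] permutes_inverses[OF perm])
  with inv have "?q \<in> carrier (Aut X)"
    by (simp add: Aut_def)
  moreover have "?q \<otimes>\<^bsub>Aut X\<^esub> p = \<one>\<^bsub>Aut X\<^esub>"
    using permutes_inv_o[OF perm] by (simp add: Aut_def)
  ultimately show "\<exists>q\<in>carrier (Aut X). q \<otimes>\<^bsub>Aut X\<^esub> p = \<one>\<^bsub>Aut X\<^esub>"
    by blast
qed (auto simp: Aut_def comp_assoc permutes_id permutes_in_image intro: permutes_compose)

end

theory Submission
  imports Defs
begin

text \<open>
  Let \<phi> be an automorphism of \<open>BX\<close>. The endpoints of an edge of \<open>X\<close> have a common neighbour, so
  their copies in one layer of \<open>BX\<close> are mapped into a common layer; as \<open>X\<close> is connected, \<phi> either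
  preserves or exchanges the two layers. Let \<alpha> be the map induced on the lower layer. Since \<phi>
  preserves numbers of common neighbours, two vertices with the same number of common neighbours as
  the ends of an edge have a positive such number and are not at distance 2, hence are adjacent.
  So \<alpha> is an automorphism of \<open>X\<close>. Finally \<open>N(fst (\<phi> (x, 1))) = \<alpha> ` N(x) = N(\<alpha> x)\<close>, whence
  \<open>fst (\<phi> (x, 1)) = \<alpha> x\<close> by twin-freeness, and \<phi> lies in the subgroup generated by lifts and \<tau>.
\<close>

section \<open>Vertices at distance two\<close>

text \<open>The walk through \<open>y\<close> bounds the infimum from above. From below, a walk with
  fewer than two arcs would give \<open>x = z\<close> or an arc from \<open>x\<close> to
  \<open>z\<close>.\<close>

lemma distance_eq_2I:
  assumes "pair_wf_digraph X" and xy: "(x, y) \<in> parcs X" and yz: "(y, z) \<in> parcs X"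
    and "x \<noteq> z" and "(x, z) \<notin> parcs X"
  shows "distance X x z = 2"
proof -
  interpret pair_wf_digraph X by fact
  have cost: "awalk_cost (\<lambda>_. 1) p = length p" for p :: "('a \<times> 'a) list"
    by (induction p) auto
  have "awalk x [(x, y), (y, z)] z"
    using xy yz by (auto simp: awalk_def in_arcsD1)
  then have "\<mu> (\<lambda>_. 1) x z \<le> ereal (awalk_cost (\<lambda>_. 1) [(x, y), (y, z)])"
    by (rule min_cost_le_walk_cost)
  moreover have "2 \<le> \<mu> (\<lambda>_. 1) x z"
    unfolding \<mu>_def
  proof (rule INF_greatest)
    fix p assume "p \<in> {p. awalk x p z}"
    then have "awalk x p z" by simp
    have "2 \<le> length p"
    proof (rule ccontr)
      assume "\<not> 2 \<le> length p"
      then consider "p = []" | e where "p = [e]"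
        by (cases p; cases "tl p") auto
      then show False
        using \<open>awalk x p z\<close> assms(4,5) by cases (auto simp: awalk_def)
    qed
    then have "ereal 2 \<le> ereal (awalk_cost (\<lambda>_. 1) p)"
      by (simp add: cost)
    then show "2 \<le> ereal (awalk_cost (\<lambda>_. 1) p)" by simp
  qed
  ultimately show ?thesis
    by (simp add: distance_def)
qed

section \<open>Automorphisms and numbers of common neighbours\<close>

lemma Aut_permutes: "\<phi> \<in> carrier (Aut X) \<Longrightarrow> \<phi> permutes pverts X"
  by (simp add: Aut_def)

lemma Aut_arcs_iff:
  "\<phi> \<in> carrier (Aut X) \<Longrightarrow> x \<in> pverts X \<Longrightarrow> y \<in> pverts X \<Longrightarrow>
    (\<phi> x, \<phi> y) \<in> parcs X \<longleftrightarrow> (x, y) \<in> parcs X"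
  by (simp add: Aut_def)

lemma (in pair_wf_digraph) neighbours_subset: "neighbours G x \<subseteq> pverts G"
  by (auto simp: neighbours_def dest: in_arcsD2)

lemma (in pair_wf_digraph) neighbours_Aut:
  assumes \<phi>: "\<phi> \<in> carrier (Aut G)" and x: "x \<in> pverts G"
  shows "neighbours G (\<phi> x) = \<phi> ` neighbours G x"
proof
  show "neighbours G (\<phi> x) \<subseteq> \<phi> ` neighbours G x"
  proof
    fix y assume y: "y \<in> neighbours G (\<phi> x)"
    then have "y \<in> pverts G" using neighbours_subset by blast
    then obtain z where "z \<in> pverts G" "y = \<phi> z"
      using permutes_image[OF Aut_permutes[OF \<phi>]] by blast
    then show "y \<in> \<phi> ` neighbours G x"
      using y Aut_arcs_iff[OF \<phi> x] by (auto simp: neighbours_def)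
  qed
  show "\<phi> ` neighbours G x \<subseteq> neighbours G (\<phi> x)"
    using Aut_arcs_iff[OF \<phi> x] by (auto simp: neighbours_def dest: in_arcsD2)
qed

lemma (in pair_wf_digraph) card_common_neighbours_Aut:
  assumes \<phi>: "\<phi> \<in> carrier (Aut G)" and "x \<in> pverts G" "y \<in> pverts G"
  shows "card (neighbours G (\<phi> x) \<inter> neighbours G (\<phi> y)) = card (neighbours G x \<inter> neighbours G y)"
proof -
  have inj: "inj \<phi>" using Aut_permutes[OF \<phi>] by (rule permutes_inj)
  have "neighbours G (\<phi> x) \<inter> neighbours G (\<phi> y) = \<phi> ` (neighbours G x \<inter> neighbours G y)"
    using assms by (simp add: neighbours_Aut image_Int[OF inj])
  then show ?thesis
    using inj by (simp add: card_image inj_on_subset)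
qed

text \<open>Turns the hypothesis on counts into a criterion for adjacency: the count of an edge is
  positive by the triangle condition, so \<open>z\<close> and \<open>w\<close> share a neighbour
  and, if not adjacent, would be at distance 2.\<close>

lemma (in pair_graph) arc_if_card_common_neighbours_eq:
  assumes tri: "edges_on_triangles G"
    and common: "\<forall>x\<in>pverts G. \<forall>y\<in>pverts G. \<forall>z\<in>pverts G. \<forall>w\<in>pverts G.
      (x, y) \<in> parcs G \<longrightarrow> distance G z w = 2 \<longrightarrow>
      card (neighbours G x \<inter> neighbours G y) \<noteq> card (neighbours G z \<inter> neighbours G w)"
    and xy: "(x, y) \<in> parcs G" and "z \<noteq> w"
    and eq: "card (neighbours G x \<inter> neighbours G y) = card (neighbours G z \<inter> neighbours G w)"
  shows "(z, w) \<in> parcs G"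
proof (rule ccontr)
  assume nadj: "(z, w) \<notin> parcs G"
  have "neighbours G x \<inter> neighbours G y \<noteq> {}"
    using tri xy by (auto simp: edges_on_triangles_def neighbours_def)
  moreover have "finite (neighbours G x \<inter> neighbours G y)"
    using finite_subset[OF neighbours_subset pair_finite_verts] by blast
  ultimately have "card (neighbours G z \<inter> neighbours G w) \<noteq> 0"
    by (simp flip: eq)
  then have "neighbours G z \<inter> neighbours G w \<noteq> {}"
    by (intro notI) simp
  then obtain v where zv: "(z, v) \<in> parcs G" and wv: "(w, v) \<in> parcs G"
    by (auto simp: neighbours_def)
  from wv have vw: "(v, w) \<in> parcs G" by (simp add: arcs_symmetric)
  have "distance G z w = 2"
    using pair_wf_digraph zv vw \<open>z \<noteq> w\<close> nadj by (rule distance_eq_2I)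
  then show False
    using common xy zv wv eq by (meson in_arcsD1 in_arcsD2)
qed

section \<open>The double cover and the embedding of the product group\<close>

lemma verts_canonical_double_cover:
  "pverts (canonical_double_cover X) = pverts X \<times> {0, 1}"
  by (simp add: canonical_double_cover_def direct_product_def K2_def)

lemma arcs_canonical_double_cover:
  "((x, i), (y, j)) \<in> parcs (canonical_double_cover X) \<longleftrightarrow>
    (x, y) \<in> parcs X \<and> (i = 0 \<and> j = 1 \<or> i = 1 \<and> j = 0)"
  by (auto simp: canonical_double_cover_def direct_product_def K2_def)

lemma neighbours_canonical_double_cover:
  "i \<in> {0, 1} \<Longrightarrow> neighbours (canonical_double_cover X) (x, i) = neighbours X x \<times> {1 - i}"
  by (auto simp: neighbours_def arcs_canonical_double_cover)

text \<open>The permutation \<open>s\<close> of \<open>{1, 2}\<close> acts on the layers \<open>{0, 1}\<close> of the cover, hence the shift by one.\<close>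
definition cover_lift ::
    "'a pair_pre_digraph \<Rightarrow> ('a \<Rightarrow> 'a) \<times> (nat \<Rightarrow> nat) \<Rightarrow> 'a \<times> nat \<Rightarrow> 'a \<times> nat" where
  "cover_lift X = (\<lambda>(f, s) (x, i).
    if x \<in> pverts X \<and> i \<in> {0, 1} then (f x, s (Suc i) - 1) else (x, i))"

lemma sym_group_2_carrier: "carrier (sym_group 2) = {id, Transposition.transpose 1 2}"
proof -
  have "{1..2::nat} = {1, 2}" by auto
  then show ?thesis by (auto simp: sym_group_def permutes_doubleton_iff)
qed

lemma cover_lift_Aut:
  assumes f: "f \<in> carrier (Aut X)" and s: "s \<in> carrier (sym_group 2)"
  shows "cover_lift X (f, s) \<in> carrier (Aut (canonical_double_cover X))"
proof -
  note perm = Aut_permutes[OF f]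
  have s': "s = id \<or> s = Transposition.transpose 1 2"
    using s by (simp add: sym_group_2_carrier)
  let ?h = "cover_lift X (f, s)"
  have "bij_betw (\<lambda>i. s (Suc i) - 1) {0, 1} {0, 1}"
    using s' by (auto simp: bij_betw_def Transposition.transpose_def)
  with permutes_imp_bij[OF perm]
  have "bij_betw (map_prod f (\<lambda>i. s (Suc i) - 1)) (pverts X \<times> {0, 1}) (pverts X \<times> {0, 1})"
    by (rule bij_betw_map_prod)
  then have bij: "bij_betw ?h (pverts X \<times> {0, 1}) (pverts X \<times> {0, 1})"
    by (rule bij_betw_cong[THEN iffD1, rotated]) (auto simp: cover_lift_def)
  have "?h permutes pverts (canonical_double_cover X)"
    unfolding verts_canonical_double_cover
    using bij by (rule bij_imp_permutes) (auto simp: cover_lift_def split: prod.split)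
  moreover have "(?h (x, i), ?h (y, j)) \<in> parcs (canonical_double_cover X) \<longleftrightarrow>
      ((x, i), (y, j)) \<in> parcs (canonical_double_cover X)"
    if "x \<in> pverts X" "y \<in> pverts X" "i \<in> {0, 1}" "j \<in> {0, 1}" for x y i j
    using s' that Aut_arcs_iff[OF f that(1,2)]
    by (auto simp: cover_lift_def arcs_canonical_double_cover Transposition.transpose_def)
  ultimately show ?thesis
    unfolding Aut_def verts_canonical_double_cover by auto
qed

lemma cover_lift_hom:
  "cover_lift X \<in> hom (Aut X \<times>\<times> sym_group 2) (Aut (canonical_double_cover X))"
proof (rule homI)
  fix p assume "p \<in> carrier (Aut X \<times>\<times> sym_group 2)"
  then show "cover_lift X p \<in> carrier (Aut (canonical_double_cover X))"
    by (cases p) (auto intro: cover_lift_Aut)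
next
  fix p q
  assume "p \<in> carrier (Aut X \<times>\<times> sym_group 2)" "q \<in> carrier (Aut X \<times>\<times> sym_group 2)"
  then obtain f s g t where p: "p = (f, s)" and q: "q = (g, t)"
    and g: "g \<in> carrier (Aut X)"
    and s: "s \<in> carrier (sym_group 2)" and t: "t \<in> carrier (sym_group 2)"
    by auto
  have g_verts: "g x \<in> pverts X \<longleftrightarrow> x \<in> pverts X" for x
    using Aut_permutes[OF g] by (rule permutes_in_image)
  \<comment> \<open>Positivity of \<open>t (Suc i)\<close> matters: only then does
    \<open>Suc (t (Suc i) - 1)\<close> give back \<open>t (Suc i)\<close> in the
    composition.\<close>
  have t_layers: "t (Suc i) \<in> {1, 2}" if "i \<in> {0, 1}" for i
    using t that by (auto simp: sym_group_2_carrier Transposition.transpose_def)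
  have "cover_lift X (f \<circ> g, s \<circ> t) z = cover_lift X (f, s) (cover_lift X (g, t) z)" for z
    using t_layers[of 0] t_layers[of 1] by (cases z) (auto simp: cover_lift_def g_verts numeral_2_eq_2)
  then show "cover_lift X (p \<otimes>\<^bsub>Aut X \<times>\<times> sym_group 2\<^esub> q) =
      cover_lift X p \<otimes>\<^bsub>Aut (canonical_double_cover X)\<^esub> cover_lift X q"
    by (simp add: p q Aut_def sym_group_mult fun_eq_iff)
qed

text \<open>The value at \<open>(x, 0)\<close> determines \<open>f x\<close> and whether
  \<open>s\<close> exchanges the layers. Without a vertex, both elements of
  \<open>sym_group 2\<close> would give the identity.\<close>

lemma cover_lift_inj:
  assumes "pverts X \<noteq> {}"
  shows "inj_on (cover_lift X) (carrier (Aut X \<times>\<times> sym_group 2))"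
proof (rule inj_onI, clarsimp)
  fix f s g t
  assume f: "f \<in> carrier (Aut X)" and g: "g \<in> carrier (Aut X)"
    and s: "s \<in> carrier (sym_group 2)" and t: "t \<in> carrier (sym_group 2)"
    and eq: "cover_lift X (f, s) = cover_lift X (g, t)"
  have eq': "(f x, s (Suc i) - 1) = (g x, t (Suc i) - 1)" if "x \<in> pverts X" "i \<in> {0, 1}" for x i
    using fun_cong[OF eq, of "(x, i)"] that by (simp add: cover_lift_def)
  have "f x = g x" for x
    using eq'[of x 0] permutes_not_in[OF Aut_permutes[OF f]] permutes_not_in[OF Aut_permutes[OF g]]
    by (cases "x \<in> pverts X") auto
  moreover from assms obtain x where "x \<in> pverts X" by blast
  then have "s = t"
    using eq'[of x 0] s t by (auto simp: sym_group_2_carrier)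
  ultimately show "f = g \<and> s = t" by auto
qed

section \<open>Automorphisms of the cover come from the product group\<close>

lemma (in pair_graph) strongly_connected_has_neighbour:
  assumes "strongly_connected (with_proj G)" and "card (pverts G) > 1" and "x \<in> pverts G"
  obtains y where "(x, y) \<in> parcs G"
proof -
  have "\<not> pverts G \<subseteq> {x}"
    using assms(2) card_mono[of "{x}" "pverts G"] by auto
  then obtain z where "z \<in> pverts G" "z \<noteq> x" by blast
  then have "x \<rightarrow>\<^sup>*\<^bsub>with_proj G\<^esub> z"
    using assms(1,3) by (auto simp: strongly_connected_def)
  then show thesis
    using \<open>z \<noteq> x\<close> that by (cases rule: converse_reachable_cases) auto
qed

text \<open>Induction along a walk: for an edge with ends \<open>y\<close>, \<open>z\<close> and a
  common neighbour \<open>v\<close>, the images of \<open>(y, 0)\<close> and \<open>(z, 0)\<close>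
  are both adjacent to the image of \<open>(v, 1)\<close>, hence lie in the layer opposite to
  it.\<close>

lemma (in pair_graph) snd_Aut_canonical_double_cover:
  assumes sc: "strongly_connected (with_proj G)" and tri: "edges_on_triangles G"
    and \<phi>: "\<phi> \<in> carrier (Aut (canonical_double_cover G))"
    and x: "x \<in> pverts G" and y: "y \<in> pverts G"
  shows "snd (\<phi> (x, 0)) = snd (\<phi> (y, 0))"
proof -
  have "x \<rightarrow>\<^sup>*\<^bsub>with_proj G\<^esub> y"
    using sc x y by (auto simp: strongly_connected_def)
  then show ?thesis
  proof (induction rule: reachable_induct)
    case base
    show ?case ..
  next
    case (step y z)
    then have yz: "(y, z) \<in> parcs G" by simp
    then obtain v where "(y, v) \<in> parcs G" "(z, v) \<in> parcs G"
      using tri unfolding edges_on_triangles_def by blast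
    moreover from this have "y \<in> pverts G" "z \<in> pverts G" "v \<in> pverts G"
      by (auto dest: in_arcsD1 in_arcsD2)
    ultimately have "(\<phi> (y, 0), \<phi> (v, 1)) \<in> parcs (canonical_double_cover G)"
        "(\<phi> (z, 0), \<phi> (v, 1)) \<in> parcs (canonical_double_cover G)"
      by (simp_all add: Aut_arcs_iff[OF \<phi>] verts_canonical_double_cover
          arcs_canonical_double_cover)
    then have "snd (\<phi> (y, 0)) = snd (\<phi> (z, 0))"
      by (cases "\<phi> (y, 0)"; cases "\<phi> (z, 0)"; cases "\<phi> (v, 1)")
        (auto simp: arcs_canonical_double_cover)
    with step show ?case by simp
  qed
qed

lemma (in pair_graph) Aut_canonical_double_cover_subset:
  assumes nontrivial: "card (pverts G) > 1"
    and sc: "strongly_connected (with_proj G)"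
    and twin: "twin_free G"
    and tri: "edges_on_triangles G"
    and common: "\<forall>x\<in>pverts G. \<forall>y\<in>pverts G. \<forall>z\<in>pverts G. \<forall>w\<in>pverts G.
      (x, y) \<in> parcs G \<longrightarrow> distance G z w = 2 \<longrightarrow>
      card (neighbours G x \<inter> neighbours G y) \<noteq> card (neighbours G z \<inter> neighbours G w)"
    and \<phi>: "\<phi> \<in> carrier (Aut (canonical_double_cover G))"
  shows "\<phi> \<in> cover_lift G ` carrier (Aut G \<times>\<times> sym_group 2)"
proof -
  let ?B = "canonical_double_cover G"
  interpret B: pair_graph ?B
    using pair_graph by (rule pair_graph_canonical_double_cover)
  note perm = Aut_permutes[OF \<phi>]
  note inj = permutes_inj[OF perm]
  obtain x0 where x0: "x0 \<in> pverts G"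
    using nontrivial by fastforce
  \<comment> \<open>The layer that receives the lower layer; the choice of \<open>x0\<close> does
    not affect it.\<close>
  define c where "c = snd (\<phi> (x0, 0))"
  define a where "a i x = fst (\<phi> (x, i))" for i x
  have verts: "\<phi> (x, i) \<in> pverts G \<times> {0, 1}" if "x \<in> pverts G" "i \<in> {0, 1}" for x i
    using that permutes_in_image[OF perm, of "(x, i)"] by (simp add: verts_canonical_double_cover)
  have c: "c \<in> {0, 1}"
    using verts[OF x0, of 0] by (auto simp: c_def)
  have a_verts: "a i x \<in> pverts G" if "x \<in> pverts G" "i \<in> {0, 1}" for x i
    using verts[OF that] by (auto simp: a_def)
  have \<phi>0: "\<phi> (x, 0) = (a 0 x, c)" if "x \<in> pverts G" for x
    using snd_Aut_canonical_double_cover[OF sc tri \<phi> that x0] by (simp add: a_def c_def prod_eq_iff)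
  have \<phi>1: "\<phi> (x, 1) = (a 1 x, 1 - c)" if x: "x \<in> pverts G" for x
  proof -
    \<comment> \<open>A neighbour in the lower layer, whose image lies in layer \<open>c\<close>,
      forces the image of \<open>(x, 1)\<close> into the other layer.\<close>
    obtain y where "(x, y) \<in> parcs G"
      using strongly_connected_has_neighbour[OF sc nontrivial x] .
    then have y: "y \<in> pverts G" "((x, 1), (y, 0)) \<in> parcs ?B"
      by (auto simp: arcs_canonical_double_cover dest: in_arcsD2)
    then have "(\<phi> (x, 1), \<phi> (y, 0)) \<in> parcs ?B"
      using x by (simp add: Aut_arcs_iff[OF \<phi>] verts_canonical_double_cover)
    then have "snd (\<phi> (x, 1)) = 1 - c"
      using \<phi>0[OF y(1)] by (cases "\<phi> (x, 1)") (auto simp: arcs_canonical_double_cover)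
    then show ?thesis
      by (simp add: a_def prod_eq_iff)
  qed
  \<comment> \<open>All images of the lower layer share the second component \<open>c\<close>, so
    injectivity of \<phi> passes to the first component.\<close>
  have a0_inj: "inj_on (a 0) (pverts G)"
    by (rule inj_onI) (metis \<phi>0 inj injD prod.inject)
  \<comment> \<open>The common neighbours of \<open>(x, 0)\<close> and \<open>(y, 0)\<close> are
    those of \<open>x\<close> and \<open>y\<close>, copied into layer 1.\<close>
  have card_a0: "card (neighbours G (a 0 x) \<inter> neighbours G (a 0 y)) =
      card (neighbours G x \<inter> neighbours G y)" if "x \<in> pverts G" "y \<in> pverts G" for x y
    using B.card_common_neighbours_Aut[OF \<phi>, of "(x, 0)" "(y, 0)"] that c
    by (simp add: verts_canonical_double_cover \<phi>0 neighbours_canonical_double_cover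
        card_cartesian_product flip: Times_Int_distrib1)
  \<comment> \<open>Equality of counts is symmetric, so the criterion applies in both directions. It
    needs distinct vertices, supplied by the absence of loops and by injectivity.\<close>
  have a0_arcs: "(a 0 x, a 0 y) \<in> parcs G \<longleftrightarrow> (x, y) \<in> parcs G"
    if x: "x \<in> pverts G" and y: "y \<in> pverts G" for x y
  proof
    assume adj: "(a 0 x, a 0 y) \<in> parcs G"
    then have "x \<noteq> y" using no_loops' by blast
    then show "(x, y) \<in> parcs G"
      using arc_if_card_common_neighbours_eq[OF tri common adj] card_a0[OF x y] by blast
  next
    assume adj: "(x, y) \<in> parcs G"
    then have "x \<noteq> y" using no_loops' by blast
    then have "a 0 x \<noteq> a 0 y" using a0_inj x y by (auto dest: inj_onD)
    then show "(a 0 x, a 0 y) \<in> parcs G"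
      using arc_if_card_common_neighbours_eq[OF tri common adj] card_a0[OF x y] by simp
  qed
  \<comment> \<open>Elements of \<open>Aut G\<close> must be the identity off the vertex
    set.\<close>
  define f where "f x = (if x \<in> pverts G then a 0 x else x)" for x
  \<comment> \<open>An injective map of a finite set into itself is surjective.\<close>
  have "bij_betw (a 0) (pverts G) (pverts G)"
    using endo_inj_surj[OF pair_finite_verts _ a0_inj] a0_inj a_verts
    by (auto simp: bij_betw_def)
  then have "bij_betw f (pverts G) (pverts G)"
    by (rule bij_betw_cong[THEN iffD1, rotated]) (simp add: f_def)
  then have "f permutes pverts G"
    by (rule bij_imp_permutes) (simp add: f_def)
  then have f: "f \<in> carrier (Aut G)"
    using a0_arcs by (simp add: Aut_def f_def)
  have a1: "a 1 x = f x" if x: "x \<in> pverts G" for x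
  proof -
    \<comment> \<open>The neighbours of \<open>(x, 1)\<close> lie in layer 0, where \<phi> acts
      through \<open>f\<close>; those of its image \<open>(a 1 x, 1 - c)\<close> lie in layer
      \<open>c\<close>.\<close>
    have "neighbours G (a 1 x) \<times> {c} = \<phi> ` (neighbours G x \<times> {0})"
      using c B.neighbours_Aut[OF \<phi>, of "(x, 1)"] x \<phi>1[OF x]
      by (elim insertE emptyE)
        (simp_all add: verts_canonical_double_cover neighbours_canonical_double_cover)
    also have "\<dots> = (f ` neighbours G x) \<times> {c}"
      using neighbours_subset[of x] \<phi>0 by (force simp: f_def)
    finally have "neighbours G (a 1 x) = neighbours G (f x)"
      using neighbours_Aut[OF f x] by blast
    then show ?thesis
      using twin a_verts[OF x, of 1] permutes_in_image[OF Aut_permutes[OF f], of x] x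
      unfolding twin_free_def by blast
  qed
  \<comment> \<open>The points 1 and 2 stand for the layers 0 and 1, so the transposition records an
    exchange of layers.\<close>
  define s where "s = (if c = 0 then id else Transposition.transpose 1 2 :: nat \<Rightarrow> nat)"
  have s: "s \<in> carrier (sym_group 2)"
    by (simp add: s_def sym_group_2_carrier)
  have "\<phi> p = cover_lift G (f, s) p" for p
  proof (cases "p \<in> pverts ?B")
    case True
    then obtain x i where p: "p = (x, i)" "x \<in> pverts G" "i = 0 \<or> i = 1"
      by (auto simp: verts_canonical_double_cover)
    then show ?thesis
      using c \<phi>0[OF p(2)] \<phi>1[OF p(2)] a1[OF p(2)]
      by (auto simp: cover_lift_def s_def f_def Transposition.transpose_def)
  next
    case False
    then show ?thesis
      using permutes_not_in[OF perm False]
      by (auto simp: cover_lift_def verts_canonical_double_cover split: prod.split)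
  qed
  then have "\<phi> = cover_lift G (f, s)" ..
  with f s show ?thesis by auto
qed

section \<open>The isomorphism and stability\<close>

theorem proposition3p5:
  fixes X :: "'a pair_pre_digraph"
  assumes "pair_graph X"
    and nontrivial: "card (pverts X) > 1"
    and "Digraph_Component.connected (with_proj X)"
    and "twin_free X"
    and "edges_on_triangles X"
    and common: "\<forall>x\<in>pverts X. \<forall>y\<in>pverts X. \<forall>z\<in>pverts X. \<forall>w\<in>pverts X.
      (x, y) \<in> parcs X \<longrightarrow> distance X z w = 2 \<longrightarrow>
      card (neighbours X x \<inter> neighbours X y) \<noteq> card (neighbours X z \<inter> neighbours X w)"
  shows "stable_graph X"
proof -
  interpret pair_graph X by fact
  let ?P = "Aut X \<times>\<times> sym_group 2" and ?B = "canonical_double_cover X"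
  \<comment> \<open>Arcs are symmetric, so connectedness yields directed walks between any two
    vertices, along which the layer argument proceeds.\<close>
  have sc: "strongly_connected (with_proj X)"
    using pair_sym_arcs assms(3) by (rule symmetric_connected_imp_strongly_connected)
  have "carrier (Aut ?B) \<subseteq> cover_lift X ` carrier ?P"
    using Aut_canonical_double_cover_subset[OF nontrivial sc assms(4,5) common] by blast
  moreover have "cover_lift X ` carrier ?P \<subseteq> carrier (Aut ?B)"
    using cover_lift_hom by (auto simp: hom_def)
  moreover have "pverts X \<noteq> {}"
    using nontrivial by auto
  ultimately have "cover_lift X \<in> iso ?P (Aut ?B)"
    by (intro isoI cover_lift_hom bij_betw_imageI cover_lift_inj) auto
  \<comment> \<open>Stability is stated with the group of the cover on the left, so the isomorphism
    has to be inverted, which uses the group structure of the product.\<close>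
  moreover have "group ?P"
    using group_Aut sym_group_is_group by (rule DirProd_group)
  ultimately show ?thesis
    unfolding stable_graph_def by (metis group.iso_sym is_isoI)
qed

end
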